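(* There is a universal constant $c$ (independent of all problem parameters) such that the following holds. Consider the caching problem with files $\mathcal{N}=\{1,\dots,N\}$ having popularities $p_1\ge p_2\ge\dots\ge p_N>0$, $K$ users, and normalized cache size $M\ge 0$. Let $\mathcal{N}_1,\dots,\mathcal{N}_L$ be the maximal partition of $\mathcal{N}$ to within popularity factor two, let $N_\ell=|\mathcal{N}_\ell|$, and let $\mathsf{K}_\ell$ be the random number of users whose demand lies in $\mathcal{N}_\ell$. Then \[ R^\star(M,\mathcal{N},K)\;\ge\;\frac{1}{cL}\sum_{\ell=1}^L \mathbb{E}\bigl(R(M,N_\ell,\mathsf{K}_\ell)\bigr). \]
   Context: Caching problem: a server holds $N$ files, each of $F$ bits, connected through a shared error-free link to $K$ users, each with a cache of $MF$ bits. In the placement phase (before demands are known), each user stores an arbitrary function of the files of at most $MF$ bits. In the delivery phase each user $k$ independently requests file $\mathsf{d}_k$ with $\Pr(\mathsf{d}_k=n)=p_n$; the server sends a message over the shared link from which, together with its cache, each user must reconstruct its requested file. The rate for a demand vector is the message length divided by $F$; $R^\star(M,\mathcal{N},K)$ denotes the infimum of expected rates (expectation over demands) achievable with vanishing error probability for all sufficiently large $F$, over all schemes. Maximal partition to within popularity factor two: $\mathcal{N}_1=\{1,\dots,N_1\}$ where $N_1$ is the largest index with $p_{N_1}\ge p_1/2$; recursively, if $n$ is the smallest file not yet assigned, the next group is $\{n,\dots,n+N_\ell-1\}$ with $p_{n+N_\ell-1}\ge p_n/2$ and $p_{n+N_\ell}<p_n/2$ (or $n+N_\ell-1=N$); $L$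 is the number of groups. $\mathsf{K}_\ell$ is Binomial$(K,\sum_{n\in\mathcal{N}_\ell}p_n)$. The function $R$ is defined for real $M\ge0$ and integers $N\ge1,K\ge0$ by $R(M,N,K)=(1-M/N)\min\{\tfrac{N}{M}(1-(1-M/N)^K),N\}$ for $M\in(0,N]$, $R(0,N,K)=\min\{N,K\}$, and $R(M,N,K)=0$ for $M>N$. *)

theory Defs
  imports "HOL-Probability.Probability"
begin

definition Rfun :: "real \<Rightarrow> nat \<Rightarrow> nat \<Rightarrow> real" where
  "Rfun M N K =
     (if M = 0 then real (min N K)
      else if 0 < M \<and> M \<le> real N then
        (1 - M / real N) * min (real N / M * (1 - (1 - M / real N) ^ K)) (real N)
      else 0)"

text \<open>Files are indexed by 1..N, users by 0..K-1. A library is an assignment of an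
  F-bit string to each file (other indices carry the empty list).\<close>

definition libraries :: "nat \<Rightarrow> nat \<Rightarrow> (nat \<Rightarrow> bool list) set" where
  "libraries N F = {W. (\<forall>n\<in>{1..N}. length (W n) = F) \<and> (\<forall>n. n \<notin> {1..N} \<longrightarrow> W n = [])}"

definition demands :: "nat \<Rightarrow> nat \<Rightarrow> (nat \<Rightarrow> nat) set" where
  "demands N K = PiE {..<K} (\<lambda>_. {1..N})"

definition demand_prob :: "(nat \<Rightarrow> real) \<Rightarrow> nat \<Rightarrow> (nat \<Rightarrow> nat) \<Rightarrow> real" where
  "demand_prob p K d = (\<Prod>k<K. p (d k))"

definition error_prob ::
  "nat \<Rightarrow> nat \<Rightarrow> nat \<Rightarrow> (nat \<Rightarrow> (nat \<Rightarrow> bool list) \<Rightarrow> bool list)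
   \<Rightarrow> ((nat \<Rightarrow> nat) \<Rightarrow> (nat \<Rightarrow> bool list) \<Rightarrow> bool list)
   \<Rightarrow> (nat \<Rightarrow> (nat \<Rightarrow> nat) \<Rightarrow> bool list \<Rightarrow> bool list \<Rightarrow> bool list)
   \<Rightarrow> (nat \<Rightarrow> nat) \<Rightarrow> real" where
  "error_prob N K F cache msg dec d =
     real (card {W \<in> libraries N F. \<exists>k<K. dec k d (msg d W) (cache k W) \<noteq> W (d k)})
     / real (card (libraries N F))"

definition good_scheme :: "real \<Rightarrow> nat \<Rightarrow> nat \<Rightarrow> (nat \<Rightarrow> real) \<Rightarrow> nat \<Rightarrow> real \<Rightarrow> real \<Rightarrow> bool" where
  "good_scheme M N K p F eps R \<longleftrightarrow>
     (\<exists>cache msg dec len.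
        (\<forall>k<K. \<forall>W\<in>libraries N F. real (length (cache k W)) \<le> M * real F) \<and>
        (\<forall>d\<in>demands N K. \<forall>W\<in>libraries N F. length (msg d W) = len d) \<and>
        (\<forall>d\<in>demands N K. error_prob N K F cache msg dec d \<le> eps) \<and>
        (\<Sum>d\<in>demands N K. demand_prob p K d * (real (len d) / real F)) \<le> R)"

definition achievable :: "real \<Rightarrow> nat \<Rightarrow> nat \<Rightarrow> (nat \<Rightarrow> real) \<Rightarrow> real \<Rightarrow> bool" where
  "achievable M N K p R \<longleftrightarrow>
     (\<forall>eps>0. \<exists>F0. \<forall>F\<ge>F0. good_scheme M N K p F eps (R + eps))"

definition Rstar :: "real \<Rightarrow> nat \<Rightarrow> nat \<Rightarrow> (nat \<Rightarrow> real) \<Rightarrow> real" where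
  "Rstar M N K p = Inf {R. achievable M N K p R}"

definition grp_end :: "(nat \<Rightarrow> real) \<Rightarrow> nat \<Rightarrow> nat \<Rightarrow> nat" where
  "grp_end p N n = Max {m \<in> {n..N}. p m \<ge> p n / 2}"

fun grp_start :: "(nat \<Rightarrow> real) \<Rightarrow> nat \<Rightarrow> nat \<Rightarrow> nat" where
  "grp_start p N 0 = 1"
| "grp_start p N (Suc l) = grp_end p N (grp_start p N l) + 1"

definition num_groups :: "(nat \<Rightarrow> real) \<Rightarrow> nat \<Rightarrow> nat" where
  "num_groups p N = (LEAST l. grp_start p N l > N)"

definition group :: "(nat \<Rightarrow> real) \<Rightarrow> nat \<Rightarrow> nat \<Rightarrow> nat set" where
  "group p N l = {grp_start p N l .. grp_end p N (grp_start p N l)}"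

end

theory Submission
  imports Defs
begin

text \<open>
  It suffices to bound the rate from below by each single group \<open>G\<close>, with \<open>n\<close> files, and to average.
  A cut-set argument, done by counting libraries, shows that for any \<open>s\<close> users and any \<open>b\<close> demand
  vectors the \<open>b\<close> rates sum up to at least the number of distinct files these users request, minus
  \<open>s M\<close> and a term that vanishes with growing file length. Condition on the set \<open>T\<close> of users whose
  demand lies in \<open>G\<close>: the demands stay independent, and each user in \<open>T\<close> requests every file of \<open>G\<close>
  with probability at least \<open>1 / (2 n)\<close>. So two averages of the cut-set bound are available. Letting
  one user of \<open>T\<close> run through all of \<open>G\<close> gives conditional expected rate at least
  \<open>(n - M) / (2 n)\<close>; taking \<open>b\<close> independent demand vectors and \<open>s \<le> |T|\<close> users gives at least
  \<open>(n (1 - (1 - 1 / (2 n)) ^ (s b)) - s M) / b\<close>. The first (for \<open>M > n / 16\<close>) or the second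
  dominates \<open>Rfun M n |T|\<close> up to a constant for every single \<open>T\<close>, and since \<open>|T|\<close> is binomial no
  concentration estimate is needed.
\<close>

section \<open>The cut-set bound\<close>

lemma card_bool_lists_length: "card {xs :: bool list. length xs = m} = 2 ^ m"
  using card_lists_length_eq[of "UNIV :: bool set" m] by (simp add: card_UNIV_bool)

lemma finite_bool_lists_length [simp]: "finite {xs :: bool list. length xs = m}"
  by (rule card_ge_0_finite) (simp add: card_bool_lists_length)

lemma card_bool_lists_length_le: "card {xs :: bool list. length xs \<le> m} \<le> 2 ^ (m + 1)"
proof -
  have "card {xs :: bool list. length xs \<le> m} = (\<Sum>i\<le>m. 2 ^ i)"
    using card_lists_length_le[of "UNIV :: bool set" m] by (simp add: card_UNIV_bool)
  also have "\<dots> \<le> 2 ^ (m + 1)"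
    by (induction m) auto
  finally show ?thesis .
qed

lemma finite_bool_lists_length_le [simp]: "finite {xs :: bool list. length xs \<le> m}"
  using finite_lists_length_le[of "UNIV :: bool set" m] by simp

lemma libraries_eq_PiE_dflt: "libraries N F = PiE_dflt {1..N} [] (\<lambda>_. {xs. length xs = F})"
  unfolding libraries_def PiE_dflt_def by blast

lemma finite_libraries [simp]: "finite (libraries N F)"
  unfolding libraries_eq_PiE_dflt by (rule finite_PiE_dflt) auto

lemma card_libraries: "card (libraries N F) = 2 ^ (F * N)"
  unfolding libraries_eq_PiE_dflt
  by (subst card_PiE_dflt) (simp_all add: card_bool_lists_length power_mult)

lemma card_le_prod_if_determined:
  assumes fin: "finite I" "\<And>i. i \<in> I \<Longrightarrow> finite (B i)"
    and range: "\<And>i x. i \<in> I \<Longrightarrow> x \<in> A \<Longrightarrow> f i x \<in> B i"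
    and determined: "\<And>x y. x \<in> A \<Longrightarrow> y \<in> A \<Longrightarrow> \<forall>i\<in>I. f i x = f i y \<Longrightarrow> x = y"
  shows "card A \<le> (\<Prod>i\<in>I. card (B i))"
proof -
  define code where "code x = (\<lambda>i\<in>I. f i x)" for x
  have "inj_on code A"
  proof (rule inj_onI)
    fix x y assume xy: "x \<in> A" "y \<in> A" and eq: "code x = code y"
    have "f i x = f i y" if "i \<in> I" for i
      using fun_cong[OF eq, of i] that by (simp add: code_def)
    with xy show "x = y"
      using determined by blast
  qed
  moreover have "code ` A \<subseteq> PiE I B"
    using range by (auto simp: code_def)
  ultimately have "card A \<le> card (PiE I B)"
    using fin by (intro card_inj_on_le finite_PiE)
  then show ?thesis
    using fin(1) by (simp add: card_PiE)
qed

lemma card_le_if_decodable: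
  fixes cache :: "'k \<Rightarrow> (nat \<Rightarrow> bool list) \<Rightarrow> bool list"
    and msg :: "'j \<Rightarrow> (nat \<Rightarrow> bool list) \<Rightarrow> bool list"
  assumes A: "A \<subseteq> libraries N F" and D: "D \<subseteq> {1..N}" and fin: "finite S" "finite J"
    and cache: "\<And>k W. k \<in> S \<Longrightarrow> W \<in> A \<Longrightarrow> length (cache k W) \<le> m"
    and msg: "\<And>j W. j \<in> J \<Longrightarrow> W \<in> A \<Longrightarrow> length (msg j W) = len j"
    and decodable: "\<And>V W. V \<in> A \<Longrightarrow> W \<in> A \<Longrightarrow> \<forall>k\<in>S. cache k V = cache k W \<Longrightarrow>
      \<forall>j\<in>J. msg j V = msg j W \<Longrightarrow> \<forall>n\<in>D. V n = W n"
  shows "card A \<le> 2 ^ ((m + 1) * card S + (\<Sum>j\<in>J. len j) + F * (N - card D))"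
proof -
  define f where "f = case_sum cache (case_sum msg (\<lambda>n W. W n))"
  define B :: "'k + 'j + nat \<Rightarrow> bool list set" where "B = case_sum (\<lambda>_. {xs. length xs \<le> m})
    (case_sum (\<lambda>j. {xs. length xs = len j}) (\<lambda>_. {xs. length xs = F}))"
  have files: "length (W n) = (if n \<in> {1..N} then F else 0)" if "W \<in> A" for W n
    using A that by (auto simp: libraries_def)
  have "card A \<le> (\<Prod>i\<in>S <+> J <+> ({1..N} - D). card (B i))"
  proof (rule card_le_prod_if_determined[where f = f])
    fix V W assume VW: "V \<in> A" "W \<in> A"
      and same: "\<forall>i\<in>S <+> J <+> ({1..N} - D). f i V = f i W"
    have same_code: "\<forall>k\<in>S. cache k V = cache k W" "\<forall>j\<in>J. msg j V = msg j W"
      "\<forall>n\<in>{1..N} - D. V n = W n"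
      using same by (simp_all add: f_def Plus_def ball_Un)
    moreover have "\<forall>n\<in>D. V n = W n"
      by (rule decodable[OF VW same_code(1,2)])
    moreover have "V n = W n" if "n \<notin> {1..N}" for n
      using files[OF VW(1), of n] files[OF VW(2), of n] that by (simp del: atLeastAtMost_iff)
    ultimately show "V = W"
      by blast
  qed (use fin cache msg files in \<open>auto simp: f_def B_def\<close>)
  also have "\<dots> = card {xs :: bool list. length xs \<le> m} ^ card S
      * (2 ^ (\<Sum>j\<in>J. len j) * 2 ^ (F * (N - card D)))"
    using fin D by (simp add: prod.Plus B_def card_bool_lists_length power_sum power_mult
        card_Diff_subset finite_subset)
  also have "\<dots> \<le> (2 ^ (m + 1)) ^ card S * (2 ^ (\<Sum>j\<in>J. len j) * 2 ^ (F * (N - card D)))"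
    by (intro mult_right_mono power_mono card_bool_lists_length_le) auto
  finally show ?thesis
    by (simp only: power_add power_mult mult.assoc)
qed

definition decoded_libraries ::
  "nat \<Rightarrow> nat \<Rightarrow> nat \<Rightarrow> (nat \<Rightarrow> (nat \<Rightarrow> bool list) \<Rightarrow> bool list)
   \<Rightarrow> ((nat \<Rightarrow> nat) \<Rightarrow> (nat \<Rightarrow> bool list) \<Rightarrow> bool list)
   \<Rightarrow> (nat \<Rightarrow> (nat \<Rightarrow> nat) \<Rightarrow> bool list \<Rightarrow> bool list \<Rightarrow> bool list)
   \<Rightarrow> (nat \<Rightarrow> nat) \<Rightarrow> (nat \<Rightarrow> bool list) set" where
  "decoded_libraries N K F cache msg dec d =
     {W \<in> libraries N F. \<forall>k<K. dec k d (msg d W) (cache k W) = W (d k)}"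

lemma card_libraries_le_decoded:
  assumes D: "finite D" "\<And>d. d \<in> D \<Longrightarrow> error_prob N K F cache msg dec d \<le> eps"
    and eps: "real (card D) * eps \<le> 1 / 2"
  shows "card (libraries N F)
    \<le> 2 * card (libraries N F \<inter> (\<Inter>d\<in>D. decoded_libraries N K F cache msg dec d))"
proof -
  define L where "L = libraries N F"
  define failed where "failed d = {W \<in> L. \<exists>k<K. dec k d (msg d W) (cache k W) \<noteq> W (d k)}" for d
  have fin: "finite L" "finite (\<Union>d\<in>D. failed d)"
    using D(1) by (auto simp: L_def failed_def)
  have "real (card (failed d)) \<le> eps * card L" if "d \<in> D" for d
    using D(2)[OF that] by (simp add: error_prob_def failed_def L_def card_libraries field_simps)
  then have "(\<Sum>d\<in>D. real (card (failed d))) \<le> real (card D) * (eps * card L)"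
    by (rule sum_bounded_above)
  also have "\<dots> \<le> 1 / 2 * card L"
    using mult_right_mono[OF eps, of "card L"] by simp
  finally have "2 * real (\<Sum>d\<in>D. card (failed d)) \<le> card L"
    by simp
  then have "2 * (\<Sum>d\<in>D. card (failed d)) \<le> card L"
    by linarith
  then have "2 * card (\<Union>d\<in>D. failed d) \<le> card L"
    using card_UN_le[OF D(1), of failed] by linarith
  moreover have "card L - card (\<Union>d\<in>D. failed d) \<le> card (L - (\<Union>d\<in>D. failed d))"
    by (rule diff_card_le_card_Diff[OF fin(2)])
  moreover have "L - (\<Union>d\<in>D. failed d) = L \<inter> (\<Inter>d\<in>D. decoded_libraries N K F cache msg dec d)"
    by (auto simp: failed_def decoded_libraries_def L_def)
  ultimately show ?thesis
    unfolding L_def by simp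
qed

lemma demands_mem: "d \<in> demands N K \<Longrightarrow> k < K \<Longrightarrow> d k \<in> {1..N}"
  using PiE_mem[of d "{..<K}" "\<lambda>_. {1..N}" k] by (simp add: demands_def)

lemma finite_demands [simp]: "finite (demands N K)"
  by (simp add: demands_def finite_PiE)

lemma card_decoded_libraries_le:
  assumes D: "D \<subseteq> demands N K" and S: "S \<subseteq> {..<K}"
    and cache: "\<And>k W. k < K \<Longrightarrow> W \<in> libraries N F \<Longrightarrow> length (cache k W) \<le> m"
    and msg: "\<And>d W. d \<in> demands N K \<Longrightarrow> W \<in> libraries N F \<Longrightarrow> length (msg d W) = len d"
  shows "card (libraries N F \<inter> (\<Inter>d\<in>D. decoded_libraries N K F cache msg dec d))
    \<le> 2 ^ ((m + 1) * card S + (\<Sum>d\<in>D. len d) + F * (N - card (\<Union>d\<in>D. d ` S)))"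
proof (rule card_le_if_decodable[where cache = cache and msg = msg])
  let ?A = "libraries N F \<inter> (\<Inter>d\<in>D. decoded_libraries N K F cache msg dec d)"
  show "(\<Union>d\<in>D. d ` S) \<subseteq> {1..N}"
    by (intro UN_least image_subsetI demands_mem[of _ N K]) (use D S in auto)
  show "length (cache k W) \<le> m" if "k \<in> S" "W \<in> ?A" for k W
    using that S by (auto intro!: cache)
  show "length (msg d W) = len d" if "d \<in> D" "W \<in> ?A" for d W
    using that D by (auto intro!: msg)
  show "finite S" "finite D"
    using D S finite_demands finite_subset by blast+
  show "\<forall>n\<in>\<Union>d\<in>D. d ` S. V n = W n" if "V \<in> ?A" "W \<in> ?A"
    and same: "\<forall>k\<in>S. cache k V = cache k W" "\<forall>d\<in>D. msg d V = msg d W" for V W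
  proof
    fix n assume "n \<in> (\<Union>d\<in>D. d ` S)"
    then obtain d k where dk: "d \<in> D" "k \<in> S" "n = d k" by blast
    have "dec k d (msg d U) (cache k U) = U n" if "U \<in> ?A" for U
      using that dk S by (auto simp: decoded_libraries_def)
    from this[OF \<open>V \<in> ?A\<close>] this[OF \<open>W \<in> ?A\<close>] show "V n = W n"
      using same dk by simp
  qed
qed blast

lemma cut_set_bound:
  assumes D: "D \<subseteq> demands N K" and S: "S \<subseteq> {..<K}"
    and cache: "\<And>k W. k < K \<Longrightarrow> W \<in> libraries N F \<Longrightarrow> length (cache k W) \<le> m"
    and msg: "\<And>d W. d \<in> demands N K \<Longrightarrow> W \<in> libraries N F \<Longrightarrow> length (msg d W) = len d"
    and err: "\<And>d. d \<in> demands N K \<Longrightarrow> error_prob N K F cache msg dec d \<le> eps"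
    and eps: "real (card D) * eps \<le> 1 / 2"
  shows "F * card (\<Union>d\<in>D. d ` S) \<le> 1 + (m + 1) * card S + (\<Sum>d\<in>D. len d)"
proof -
  define n where "n = card (\<Union>d\<in>D. d ` S)"
  define A where "A = libraries N F \<inter> (\<Inter>d\<in>D. decoded_libraries N K F cache msg dec d)"
  have "finite D"
    using D finite_demands finite_subset by blast
  then have "2 ^ (F * N) \<le> 2 * card A"
    unfolding A_def card_libraries[symmetric]
    by (rule card_libraries_le_decoded[OF _ err eps]) (use D in auto)
  also have "\<dots> \<le> 2 * 2 ^ ((m + 1) * card S + (\<Sum>d\<in>D. len d) + F * (N - n))"
    unfolding A_def n_def
    using card_decoded_libraries_le[where cache = cache and msg = msg, OF D S cache msg] by simp
  also have "\<dots> = 2 ^ (1 + (m + 1) * card S + (\<Sum>d\<in>D. len d) + F * (N - n))"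
    by (simp only: power_add power_one_right mult.assoc)
  finally have "F * N \<le> 1 + (m + 1) * card S + (\<Sum>d\<in>D. len d) + F * (N - n)"
    by (rule power_le_imp_le_exp[rotated]) simp
  moreover have "(\<Union>d\<in>D. d ` S) \<subseteq> {1..N}"
    by (intro UN_least image_subsetI demands_mem[of _ N K]) (use D S in auto)
  then have "n \<le> N"
    using card_mono[of "{1..N}"] by (simp add: n_def)
  then have "F * N = F * n + F * (N - n)"
    by (simp flip: add_mult_distrib2)
  ultimately show ?thesis
    unfolding n_def by linarith
qed

text \<open>What the lower bound needs from a scheme; \<open>\<delta>\<close> tends to \<open>0\<close> as the files get longer.\<close>

locale cut_set_rates =
  fixes M :: real and N K :: nat and \<delta> :: real and r :: "(nat \<Rightarrow> nat) \<Rightarrow> real"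
  assumes cache_nonneg: "0 \<le> M" and slack_nonneg: "0 \<le> \<delta>"
    and rate_nonneg: "d \<in> demands N K \<Longrightarrow> 0 \<le> r d"
    and cut_set: "D \<subseteq> demands N K \<Longrightarrow> card D \<le> N \<Longrightarrow> S \<subseteq> {..<K} \<Longrightarrow>
      real (card (\<Union>d\<in>D. d ` S)) \<le> (\<Sum>d\<in>D. r d) + real (card S) * M + \<delta>"

lemma (in cut_set_rates) cut_set_family:
  assumes J: "finite J" "card J \<le> N" "f ` J \<subseteq> demands N K" and S: "S \<subseteq> {..<K}"
  shows "real (card (\<Union>j\<in>J. f j ` S)) \<le> (\<Sum>j\<in>J. r (f j)) + real (card S) * M + \<delta>"
proof -
  have "card (f ` J) \<le> N"
    using card_image_le[OF J(1), of f] J(2) by linarith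
  then have "real (card (\<Union>d\<in>f ` J. d ` S)) \<le> (\<Sum>d\<in>f ` J. r d) + real (card S) * M + \<delta>"
    by (rule cut_set[OF J(3) _ S])
  moreover have "(\<Sum>d\<in>f ` J. r d) \<le> (\<Sum>j\<in>J. r (f j))"
    using sum_image_le[OF J(1), of r f] rate_nonneg J(3) by (auto simp: o_def)
  ultimately show ?thesis
    by simp
qed

definition expected_rate :: "(nat \<Rightarrow> real) \<Rightarrow> nat \<Rightarrow> nat \<Rightarrow> ((nat \<Rightarrow> nat) \<Rightarrow> real) \<Rightarrow> real" where
  "expected_rate p N K r = (\<Sum>d\<in>demands N K. demand_prob p K d * r d)"

lemma good_scheme_imp_cut_set_rates:
  assumes good: "good_scheme M N K p F eps R" and F: "F > 0" and M: "0 \<le> M"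
    and eps: "eps > 0" "real N * eps \<le> 1 / 2"
  shows "\<exists>r. cut_set_rates M N K ((real K + 1) / real F) r \<and> expected_rate p N K r \<le> R"
proof -
  from good obtain cache msg dec len where
    cache: "\<And>k W. k < K \<Longrightarrow> W \<in> libraries N F \<Longrightarrow> real (length (cache k W)) \<le> M * real F" and
    msg: "\<And>d W. d \<in> demands N K \<Longrightarrow> W \<in> libraries N F \<Longrightarrow> length (msg d W) = len d" and
    err: "\<And>d. d \<in> demands N K \<Longrightarrow> error_prob N K F cache msg dec d \<le> eps" and
    rate: "expected_rate p N K (\<lambda>d. real (len d) / real F) \<le> R"
    unfolding good_scheme_def expected_rate_def by blast
  define m where "m = nat \<lfloor>M * real F\<rfloor>"
  have m: "real m \<le> M * real F" unfolding m_def using M by simp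
  have cache_m: "length (cache k W) \<le> m" if "k < K" "W \<in> libraries N F" for k W
    using cache[OF that] unfolding m_def by (simp add: le_nat_floor)
  have "cut_set_rates M N K ((real K + 1) / real F) (\<lambda>d. real (len d) / real F)"
  proof
    fix D S assume D: "D \<subseteq> demands N K" "card D \<le> N" and S: "S \<subseteq> {..<K}"
    have "real (card D) * eps \<le> real N * eps"
      using D(2) eps(1) by (intro mult_right_mono) auto
    with eps have eps_D: "real (card D) * eps \<le> 1 / 2" by linarith
    have "F * card (\<Union>d\<in>D. d ` S) \<le> 1 + (m + 1) * card S + (\<Sum>d\<in>D. len d)"
      by (rule cut_set_bound[where cache = cache and msg = msg, OF D(1) S cache_m msg err eps_D])
    from of_nat_mono[OF this, where 'a = real] have "real F * real (card (\<Union>d\<in>D. d ` S))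
        \<le> 1 + real (card S) + real m * real (card S) + (\<Sum>d\<in>D. real (len d))"
      by (simp add: algebra_simps)
    also have "\<dots> \<le> 1 + real K + M * real F * real (card S) + (\<Sum>d\<in>D. real (len d))"
      using m card_mono[OF _ S] by (intro add_mono mult_right_mono) auto
    finally have "real (card (\<Union>d\<in>D. d ` S))
        \<le> (1 + real K + M * real F * real (card S) + (\<Sum>d\<in>D. real (len d))) / real F"
      using F by (simp add: pos_le_divide_eq mult.commute)
    also have "\<dots> = (\<Sum>d\<in>D. real (len d) / real F) + real (card S) * M + (real K + 1) / real F"
      using F by (simp add: add_divide_distrib flip: sum_divide_distrib)
    finally show "real (card (\<Union>d\<in>D. d ` S))
        \<le> (\<Sum>d\<in>D. real (len d) / real F) + real (card S) * M + (real K + 1) / real F" .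
  qed (use M in auto)
  with rate show ?thesis by blast
qed

section \<open>Comparing the cut-set bounds with \<open>Rfun\<close>\<close>

lemma Rfun_0_files [simp]: "Rfun M 0 = (\<lambda>_. 0)"
  by (auto simp: Rfun_def)

lemma Rfun_0_users [simp]: "Rfun M n 0 = 0"
  by (simp add: Rfun_def)

lemma Rfun_eq_0: "real n < M \<Longrightarrow> Rfun M n k = 0"
  by (simp add: Rfun_def)

lemma Rfun_le_files: "Rfun M n k \<le> real n"
proof (cases "0 < M \<and> M \<le> real n")
  case True
  then have "Rfun M n k = (1 - M / real n) * min (real n / M * (1 - (1 - M / real n) ^ k)) (real n)"
    by (simp add: Rfun_def)
  also have "\<dots> \<le> 1 * real n"
    using True by (intro mult_mono) (auto simp: power_le_one)
  finally show ?thesis by simp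
qed (auto simp: Rfun_def)

lemma Rfun_le_users: "Rfun M n k \<le> real k"
proof (cases "0 < M \<and> M \<le> real n")
  case True
  define y where "y = M / real n"
  have y: "0 < y" "y \<le> 1" using True by (auto simp: y_def)
  have "Rfun M n k = (1 - y) * min ((1 - (1 - y) ^ k) / y) (real n)"
    using True by (simp add: Rfun_def y_def mult.commute)
  also have "\<dots> \<le> 1 * ((1 - (1 - y) ^ k) / y)"
    using y by (intro mult_mono) (auto simp: power_le_one)
  also have "1 - real k * y \<le> (1 - y) ^ k"
    using Bernoulli_inequality[of "- y" k] y by simp
  then have "1 * ((1 - (1 - y) ^ k) / y) \<le> real k"
    using y by (simp add: divide_le_eq)
  finally show ?thesis .
qed (auto simp: Rfun_def)

lemma Rfun_le_cache:
  assumes "0 < M" "M \<le> real n"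
  shows "Rfun M n k \<le> (real n - M) / M"
proof -
  have "Rfun M n k = (1 - M / real n) * min (real n / M * (1 - (1 - M / real n) ^ k)) (real n)"
    using assms by (simp add: Rfun_def)
  also have "\<dots> \<le> (1 - M / real n) * (real n / M * 1)"
    using assms by (intro mult_left_mono min.coboundedI1) auto
  also have "\<dots> = (real n - M) / M"
    using assms by (simp add: field_simps)
  finally show ?thesis .
qed

lemma Rfun_le_sweep_bound:
  assumes "0 < n" "M \<le> real n" "real n < 16 * M"
  shows "Rfun M n k / 160 \<le> 1 / (2 * real n) * (real n - M)"
proof -
  have "Rfun M n k \<le> (real n - M) / M"
    using assms by (intro Rfun_le_cache) auto
  also have "\<dots> \<le> (real n - M) / (real n / 16)"
    using assms by (intro divide_left_mono) auto
  finally show ?thesis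
    using assms by (simp add: field_simps)
qed

lemma obtain_num_users:
  assumes M: "0 \<le> M" "16 * M \<le> real n" and n: "1 \<le> n" and k: "1 \<le> k"
  obtains s where "1 \<le> s" "s \<le> k" "s \<le> n" "16 * (real s * M) \<le> real n" "Rfun M n k \<le> 32 * real s"
proof -
  define fits where "fits s \<longleftrightarrow> s \<le> k \<and> s \<le> n \<and> 16 * (real s * M) \<le> real n" for s
  have "fits 1" using M n k by (simp add: fits_def)
  then obtain s where s: "fits s" and max: "\<And>t. fits t \<Longrightarrow> t \<le> s"
    using Nat.ex_has_greatest_nat[of fits 1 n] unfolding fits_def by blast
  have "1 \<le> s" using max[OF \<open>fits 1\<close>] .
  have "\<not> fits (s + 1)" using max[of "s + 1"] by auto
  then consider "s = k" | "s = n" | "real n < 16 * (real (s + 1) * M)"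
    using s unfolding fits_def by linarith
  then have "Rfun M n k \<le> 32 * real s"
  proof cases
    case 1
    then show ?thesis using Rfun_le_users[of M n k] by simp
  next
    case 2
    then show ?thesis using Rfun_le_files[of M n k] by simp
  next
    case 3
    then have "M \<noteq> 0" by auto
    then have "M > 0" using M by simp
    then have "Rfun M n k \<le> (real n - M) / M" using M by (intro Rfun_le_cache) auto
    also have "\<dots> \<le> 16 * real (s + 1)" using 3 \<open>M > 0\<close> by (simp add: divide_le_eq algebra_simps)
    also have "\<dots> \<le> 32 * real s" using \<open>1 \<le> s\<close> by simp
    finally show ?thesis .
  qed
  with s \<open>1 \<le> s\<close> show thesis
    using that unfolding fits_def by blast
qed

lemma one_minus_power_le_inverse:
  fixes y :: real
  assumes "0 \<le> y" "y \<le> 1"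
  shows "(1 - y) ^ m \<le> 1 / (1 + real m * y)"
proof -
  have "(1 - y) ^ m * (1 + real m * y) \<le> (1 - y) ^ m * (1 + y) ^ m"
    using Bernoulli_inequality[of y m] assms by (intro mult_left_mono) auto
  also have "\<dots> = (1 - y\<^sup>2) ^ m"
    by (simp add: power2_eq_square algebra_simps flip: power_mult_distrib)
  also have "\<dots> \<le> 1" using assms by (intro power_le_one) (auto simp: power_le_one)
  finally show ?thesis
    using assms by (simp add: pos_le_divide_eq add_pos_nonneg)
qed

lemma distinct_files_ge:
  assumes "1 \<le> n" "m \<le> n"
  shows "real m / 3 \<le> real n * (1 - (1 - 1 / (2 * real n)) ^ m)"
proof -
  define t where "t = real m * (1 / (2 * real n))"
  have t: "0 \<le> t" "t \<le> 1 / 2" using assms by (auto simp: t_def field_simps)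
  have "(1 - 1 / (2 * real n)) ^ m \<le> 1 / (1 + t)"
    unfolding t_def using assms by (intro one_minus_power_le_inverse) auto
  also have "\<dots> \<le> 1 - 2 / 3 * t"
  proof -
    have "0 \<le> t * (1 / 2 - t)" using t by (intro mult_nonneg_nonneg) auto
    then have "1 \<le> (1 - 2 / 3 * t) * (1 + t)" by (simp add: algebra_simps)
    then show ?thesis using t by (simp add: pos_divide_le_eq)
  qed
  finally have "real n * (2 / 3 * t) \<le> real n * (1 - (1 - 1 / (2 * real n)) ^ m)"
    by (intro mult_left_mono) auto
  then show ?thesis
    using assms by (simp add: t_def)
qed

text \<open>The caches of the \<open>s\<close> users hold only a small fraction of the group, and \<open>b\<close> is of order
  \<open>n / s\<close>, so that the \<open>s * b\<close> demands still hit a number of distinct files proportional to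
  \<open>s * b\<close>.\<close>

lemma Rfun_le_repeated_bound:
  assumes M: "0 \<le> M" "16 * M \<le> real n" and n: "1 \<le> n" and k: "1 \<le> k"
  obtains s b where "s \<le> k" "1 \<le> b" "b \<le> n"
    "real b * (Rfun M n k / 160) \<le> real n * (1 - (1 - 1 / (2 * real n)) ^ (s * b)) - real s * M"
proof -
  obtain s where s: "1 \<le> s" "s \<le> k" "s \<le> n" "16 * (real s * M) \<le> real n"
    and Rfun: "Rfun M n k \<le> 32 * real s"
    using obtain_num_users[OF assms] by blast
  define b where "b = n div s"
  have b: "1 \<le> b" "b \<le> n" "s * b \<le> n"
    unfolding b_def using s by (auto simp: div_greater_zero_iff Suc_le_eq)
  have "n < s * (b + 1)"
    unfolding b_def using s(1) by (simp add: dividend_less_times_div)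
  also have "\<dots> \<le> s * (2 * b)"
    using b(1) by (intro mult_left_mono) auto
  finally have "real n \<le> real (s * (2 * b))"
    by (intro of_nat_mono less_imp_le)
  then have "real s * M \<le> real (s * b) / 8"
    using s(4) by simp
  moreover have "real (s * b) / 3 \<le> real n * (1 - (1 - 1 / (2 * real n)) ^ (s * b))"
    by (rule distinct_files_ge[OF n b(3)])
  moreover have "real b * (Rfun M n k / 160) \<le> real (s * b) / 5"
    using mult_left_mono[OF Rfun, of "real b"] by (simp add: mult_ac)
  moreover have "0 \<le> real (s * b)"
    by simp
  ultimately have "real b * (Rfun M n k / 160)
      \<le> real n * (1 - (1 - 1 / (2 * real n)) ^ (s * b)) - real s * M"
    by linarith
  with s(2) b(1,2) show thesis by (rule that)
qed

section \<open>Independent demands\<close>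

lemma expectation_bind_pmf_ge:
  fixes g :: "'a \<Rightarrow> real" and h :: "'b \<Rightarrow> real"
  assumes fin: "finite (set_pmf p)" "\<And>x. x \<in> set_pmf p \<Longrightarrow> finite (set_pmf (f x))"
    and ge: "\<And>x. x \<in> set_pmf p \<Longrightarrow> g x \<le> measure_pmf.expectation (f x) h"
  shows "measure_pmf.expectation p g \<le> measure_pmf.expectation (bind_pmf p f) h"
proof -
  have "measure_pmf.expectation p g = (\<Sum>x\<in>set_pmf p. pmf p x * g x)"
    using fin(1) by (simp add: integral_measure_pmf[of "set_pmf p"])
  also have "\<dots> \<le> (\<Sum>x\<in>set_pmf p. pmf p x * measure_pmf.expectation (f x) h)"
    by (intro sum_mono mult_left_mono ge) auto
  also have "\<dots> = measure_pmf.expectation (bind_pmf p f) h"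
    using fin by (simp add: pmf_expectation_bind[of "set_pmf p"])
  finally show ?thesis .
qed

lemma expectation_card_Int:
  assumes "finite G"
  shows "measure_pmf.expectation P (\<lambda>x. real (card (A x \<inter> G)))
    = (\<Sum>i\<in>G. measure_pmf.prob P {x. i \<in> A x})"
proof -
  have "real (card (A x \<inter> G)) = (\<Sum>i\<in>G. indicator {x. i \<in> A x} x)" for x
    using assms by (simp add: indicator_def Int_commute Int_def flip: of_bool_def)
  moreover have "integrable P (indicat_real B)" for B
    by (rule measure_pmf.integrable_const_bound[of _ 1]) auto
  ultimately show ?thesis
    by simp
qed

lemma prob_Pi_pmf_avoid:
  assumes "finite A" "S \<subseteq> A"
  shows "measure_pmf.prob (Pi_pmf A dflt D) {f. i \<notin> f ` S} = (\<Prod>k\<in>S. 1 - pmf (D k) i)"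
proof -
  have "{f. i \<notin> f ` S} = Pi A (\<lambda>k. if k \<in> S then - {i} else UNIV)"
    using assms(2) by (fastforce simp: Pi_iff)
  then have "measure_pmf.prob (Pi_pmf A dflt D) {f. i \<notin> f ` S}
      = (\<Prod>k\<in>A. measure_pmf.prob (D k) (if k \<in> S then - {i} else UNIV))"
    by (simp only: measure_Pi_pmf_Pi[OF assms(1)])
  also have "\<dots> = (\<Prod>k\<in>S. measure_pmf.prob (D k) (- {i}))"
    using assms by (intro prod.mono_neutral_cong_right) auto
  also have "\<dots> = (\<Prod>k\<in>S. 1 - pmf (D k) i)"
    using measure_pmf.prob_compl[of "{i}"] by (simp add: Compl_eq_Diff_UNIV measure_pmf_single)
  finally show ?thesis .
qed

lemma prob_Pi_pmf_iid_UN: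
  assumes "finite J"
  shows "measure_pmf.prob (Pi_pmf J dflt (\<lambda>_. P)) {f. i \<in> (\<Union>j\<in>J. A (f j))}
    = 1 - measure_pmf.prob P {x. i \<notin> A x} ^ card J"
proof -
  have "{f. i \<in> (\<Union>j\<in>J. A (f j))} = - Pi J (\<lambda>_. {x. i \<notin> A x})"
    by auto
  then show ?thesis
    using measure_Pi_pmf_Pi[OF assms, of dflt "\<lambda>_. P" "\<lambda>_. {x. i \<notin> A x}"]
      measure_pmf.prob_compl[of "Pi J (\<lambda>_. {x. i \<notin> A x})" "Pi_pmf J dflt (\<lambda>_. P)"]
    by (simp add: Compl_eq_Diff_UNIV)
qed

definition demand_pmf :: "nat \<Rightarrow> (nat \<Rightarrow> nat pmf) \<Rightarrow> (nat \<Rightarrow> nat) pmf" where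
  "demand_pmf K D = Pi_pmf {..<K} undefined D"

lemma set_demand_pmf_subset:
  assumes "\<forall>k<K. set_pmf (D k) \<subseteq> {1..N}"
  shows "set_pmf (demand_pmf K D) \<subseteq> demands N K"
  using assms by (fastforce simp: demand_pmf_def demands_def set_Pi_pmf PiE_dflt_def)

lemma finite_set_demand_pmf:
  assumes "\<forall>k<K. set_pmf (D k) \<subseteq> {1..N}"
  shows "finite (set_pmf (demand_pmf K D))"
  by (rule finite_subset[OF set_demand_pmf_subset[OF assms] finite_demands])

lemma demand_pmf_resample:
  assumes "k < K"
  shows "demand_pmf K D
    = bind_pmf (Pi_pmf ({..<K} - {k}) undefined D) (\<lambda>d. map_pmf (\<lambda>i. d(k := i)) (D k))"
proof -
  have "{..<K} = insert k ({..<K} - {k})"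
    using assms by auto
  then have "demand_pmf K D = Pi_pmf (insert k ({..<K} - {k})) undefined D"
    by (simp add: demand_pmf_def)
  also have "\<dots> = bind_pmf (D k) (\<lambda>i.
      bind_pmf (Pi_pmf ({..<K} - {k}) undefined D) (\<lambda>d. return_pmf (d(k := i))))"
    by (subst Pi_pmf_insert') auto
  finally show ?thesis
    unfolding map_pmf_def by (subst bind_commute_pmf)
qed

lemma expected_num_requested_ge:
  assumes S: "S \<subseteq> {..<K}" and G: "finite G"
    and q: "\<And>k i. k \<in> S \<Longrightarrow> i \<in> G \<Longrightarrow> q \<le> pmf (D k) i"
  shows "real (card G) * (1 - (1 - q) ^ (card S * b))
    \<le> measure_pmf.expectation (Pi_pmf {..<b} dflt (\<lambda>_. demand_pmf K D))
        (\<lambda>f. real (card ((\<Union>j<b. f j ` S) \<inter> G)))"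
proof -
  have avoid: "measure_pmf.prob (demand_pmf K D) {d. i \<notin> d ` S} \<le> (1 - q) ^ card S"
    if "i \<in> G" for i
  proof -
    have "measure_pmf.prob (demand_pmf K D) {d. i \<notin> d ` S} = (\<Prod>k\<in>S. 1 - pmf (D k) i)"
      unfolding demand_pmf_def by (rule prob_Pi_pmf_avoid[OF _ S]) simp
    also have "\<dots> \<le> (\<Prod>k\<in>S. 1 - q)"
      using q that by (intro prod_mono) (auto simp: pmf_le_1)
    finally show ?thesis by simp
  qed
  have "real (card G) * (1 - (1 - q) ^ (card S * b)) = (\<Sum>i\<in>G. 1 - ((1 - q) ^ card S) ^ b)"
    by (simp add: power_mult)
  also have "\<dots> \<le> (\<Sum>i\<in>G. 1 - measure_pmf.prob (demand_pmf K D) {d. i \<notin> d ` S} ^ b)"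
    using avoid by (intro sum_mono diff_left_mono power_mono) auto
  also have "\<dots> = measure_pmf.expectation (Pi_pmf {..<b} dflt (\<lambda>_. demand_pmf K D))
      (\<lambda>f. real (card ((\<Union>j<b. f j ` S) \<inter> G)))"
    unfolding expectation_card_Int[OF G]
    using prob_Pi_pmf_iid_UN[of "{..<b}" dflt "demand_pmf K D" _ "\<lambda>d. d ` S"] by simp
  finally show ?thesis .
qed

context cut_set_rates
begin

lemma expected_rate_nonneg:
  assumes "\<forall>k<K. set_pmf (D k) \<subseteq> {1..N}"
  shows "0 \<le> measure_pmf.expectation (demand_pmf K D) r"
  using set_demand_pmf_subset[OF assms] rate_nonneg
  by (intro integral_nonneg_AE) (auto simp: AE_measure_pmf_iff)

lemma expected_rate_sweep:
  assumes D: "\<forall>k<K. set_pmf (D k) \<subseteq> {1..N}" and k: "k < K" and G: "G \<subseteq> {1..N}"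
    and q: "0 \<le> q" "\<And>i. i \<in> G \<Longrightarrow> q \<le> pmf (D k) i"
  shows "q * (real (card G) - M - \<delta>) \<le> measure_pmf.expectation (demand_pmf K D) r"
proof -
  define others where "others = Pi_pmf ({..<K} - {k}) undefined D"
  have fin: "finite (set_pmf (D j))" if "j < K" for j
    using D that finite_subset by blast
  have upd: "d(k := i) \<in> demands N K" if "d \<in> set_pmf others" "i \<in> {1..N}" for d i
    using that D k
    by (fastforce simp: others_def set_Pi_pmf PiE_dflt_def demands_def PiE_iff extensional_def)
  have "q * (real (card G) - M - \<delta>) \<le> measure_pmf.expectation (map_pmf (\<lambda>i. d(k := i)) (D k)) r"
    if d: "d \<in> set_pmf others" for d
  proof -
    have rate: "0 \<le> r (d(k := i))" if "i \<in> {1..N}" for i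
      by (rule rate_nonneg[OF upd[OF d that]])
    have "finite G" "card G \<le> N" "(\<lambda>i. d(k := i)) ` G \<subseteq> demands N K" "{k} \<subseteq> {..<K}"
      using G k upd[OF d] card_mono[OF _ G] finite_subset[OF G] by auto
    from cut_set_family[OF this]
    have "real (card G) \<le> (\<Sum>i\<in>G. r (d(k := i))) + M + \<delta>"
      by simp
    then have "q * (real (card G) - M - \<delta>) \<le> q * (\<Sum>i\<in>G. r (d(k := i)))"
      using q(1) by (intro mult_left_mono) auto
    also have "\<dots> \<le> (\<Sum>i\<in>G. pmf (D k) i * r (d(k := i)))"
      unfolding sum_distrib_left using G q rate by (intro sum_mono mult_right_mono) auto
    also have "\<dots> \<le> (\<Sum>i\<in>{1..N}. pmf (D k) i * r (d(k := i)))"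
      using G rate by (intro sum_mono2 mult_nonneg_nonneg) auto
    also have "\<dots> = measure_pmf.expectation (map_pmf (\<lambda>i. d(k := i)) (D k)) r"
      using D k by (simp add: integral_measure_pmf[of "{1..N}"] subset_iff)
    finally show ?thesis .
  qed
  moreover have "finite (set_pmf others)"
    unfolding others_def using fin by (subst set_Pi_pmf) (auto intro!: finite_PiE_dflt)
  ultimately have "measure_pmf.expectation others (\<lambda>_. q * (real (card G) - M - \<delta>))
      \<le> measure_pmf.expectation (bind_pmf others (\<lambda>d. map_pmf (\<lambda>i. d(k := i)) (D k))) r"
    using fin k by (intro expectation_bind_pmf_ge) auto
  then show ?thesis
    unfolding demand_pmf_resample[OF k] others_def by simp
qed

lemma expected_rate_repeated:
  assumes D: "\<forall>k<K. set_pmf (D k) \<subseteq> {1..N}" and S: "S \<subseteq> {..<K}" and G: "finite G"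
    and q: "\<And>k i. k \<in> S \<Longrightarrow> i \<in> G \<Longrightarrow> q \<le> pmf (D k) i" and b: "b \<le> N"
  shows "real (card G) * (1 - (1 - q) ^ (card S * b)) - real (card S) * M - \<delta>
    \<le> real b * measure_pmf.expectation (demand_pmf K D) r"
proof -
  define P where "P = Pi_pmf {..<b} undefined (\<lambda>_. demand_pmf K D)"
  have "finite (set_pmf P)"
    unfolding P_def using finite_set_demand_pmf[OF D]
    by (subst set_Pi_pmf) (auto intro!: finite_PiE_dflt)
  then have int: "integrable P f" for f :: "_ \<Rightarrow> real"
    by (rule integrable_measure_pmf_finite)
  have cut: "real (card ((\<Union>j<b. f j ` S) \<inter> G)) \<le> (\<Sum>j<b. r (f j)) + real (card S) * M + \<delta>"
    if "f \<in> set_pmf P" for f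
  proof -
    have "f ` {..<b} \<subseteq> demands N K"
      using that set_demand_pmf_subset[OF D] by (fastforce simp: P_def set_Pi_pmf PiE_dflt_def)
    then have "real (card (\<Union>j<b. f j ` S)) \<le> (\<Sum>j<b. r (f j)) + real (card S) * M + \<delta>"
      using b by (intro cut_set_family S) auto
    moreover have "card ((\<Union>j<b. f j ` S) \<inter> G) \<le> card (\<Union>j<b. f j ` S)"
      using S finite_subset by (intro card_mono) auto
    ultimately show ?thesis by linarith
  qed
  have "real (card G) * (1 - (1 - q) ^ (card S * b))
      \<le> measure_pmf.expectation P (\<lambda>f. real (card ((\<Union>j<b. f j ` S) \<inter> G)))"
    unfolding P_def by (rule expected_num_requested_ge[OF S G q])
  also have "\<dots> \<le> measure_pmf.expectation P (\<lambda>f. (\<Sum>j<b. r (f j)) + real (card S) * M + \<delta>)"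
    using cut by (intro integral_mono_AE int) (simp add: AE_measure_pmf_iff)
  also have "\<dots> = (\<Sum>j<b. measure_pmf.expectation (map_pmf (\<lambda>f. f j) P) r) + real (card S) * M + \<delta>"
    by (simp add: int)
  also have "\<dots> = real b * measure_pmf.expectation (demand_pmf K D) r + real (card S) * M + \<delta>"
    by (simp add: P_def Pi_pmf_component del: integral_map_pmf)
  finally show ?thesis by simp
qed

lemma Rfun_le_expected_rate_large_cache:
  assumes D: "\<forall>k<K. set_pmf (D k) \<subseteq> {1..N}" and G: "G \<subseteq> {1..N}"
    and unif: "\<And>i. i \<in> G \<Longrightarrow> 1 / (2 * real (card G)) \<le> pmf (D k) i" and k: "k < K"
    and M: "M \<le> real (card G)" "real (card G) < 16 * M"
  shows "Rfun M (card G) m / 160 - \<delta> \<le> measure_pmf.expectation (demand_pmf K D) r"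
proof -
  have "card G > 0"
    using M by linarith
  then have "Rfun M (card G) m / 160 \<le> 1 / (2 * real (card G)) * (real (card G) - M)"
    using M by (intro Rfun_le_sweep_bound)
  moreover have "1 / (2 * real (card G)) * \<delta> \<le> 1 * \<delta>"
    using \<open>card G > 0\<close> slack_nonneg by (intro mult_right_mono) auto
  moreover have "1 / (2 * real (card G)) * (real (card G) - M - \<delta>)
      \<le> measure_pmf.expectation (demand_pmf K D) r"
    by (rule expected_rate_sweep[OF D k G _ unif]) auto
  ultimately show ?thesis
    by (simp add: right_diff_distrib)
qed

lemma Rfun_le_expected_rate_small_cache:
  assumes D: "\<forall>k<K. set_pmf (D k) \<subseteq> {1..N}" and G: "G \<subseteq> {1..N}" "G \<noteq> {}"
    and T: "T \<subseteq> {..<K}" "T \<noteq> {}"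
    and unif: "\<And>k i. k \<in> T \<Longrightarrow> i \<in> G \<Longrightarrow> 1 / (2 * real (card G)) \<le> pmf (D k) i"
    and M: "16 * M \<le> real (card G)"
  shows "Rfun M (card G) (card T) / 160 - \<delta> \<le> measure_pmf.expectation (demand_pmf K D) r"
proof -
  have fin: "finite G" "finite T"
    using G T finite_subset by blast+
  then have "1 \<le> card G" "1 \<le> card T"
    using G T by (simp_all add: Suc_le_eq card_gt_0_iff)
  then obtain s b where sb: "s \<le> card T" "1 \<le> b" "b \<le> card G" and
    Rfun: "real b * (Rfun M (card G) (card T) / 160)
      \<le> real (card G) * (1 - (1 - 1 / (2 * real (card G))) ^ (s * b)) - real s * M"
    using Rfun_le_repeated_bound[OF cache_nonneg M] by blast
  obtain S where S: "S \<subseteq> T" "card S = s"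
    using sb(1) by (rule obtain_subset_with_card_n)
  have "b \<le> N"
    using sb(3) card_mono[OF _ G(1)] by simp
  then have "real (card G) * (1 - (1 - 1 / (2 * real (card G))) ^ (s * b)) - real s * M - \<delta>
      \<le> real b * measure_pmf.expectation (demand_pmf K D) r"
    unfolding S(2)[symmetric] using S(1) T(1) unif
    by (intro expected_rate_repeated[OF D _ fin(1)]) auto
  moreover have "1 * \<delta> \<le> real b * \<delta>"
    using sb(2) slack_nonneg by (intro mult_right_mono) auto
  ultimately have "real b * (Rfun M (card G) (card T) / 160 - \<delta>)
      \<le> real b * measure_pmf.expectation (demand_pmf K D) r"
    using Rfun by (simp add: right_diff_distrib)
  then show ?thesis
    using sb(2) by simp
qed

lemma Rfun_le_expected_rate:
  assumes D: "\<forall>k<K. set_pmf (D k) \<subseteq> {1..N}" and G: "G \<subseteq> {1..N}" and T: "T \<subseteq> {..<K}"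
    and unif: "\<And>k i. k \<in> T \<Longrightarrow> i \<in> G \<Longrightarrow> 1 / (2 * real (card G)) \<le> pmf (D k) i"
  shows "Rfun M (card G) (card T) / 160 - \<delta> \<le> measure_pmf.expectation (demand_pmf K D) r"
proof -
  consider "T = {} \<or> G = {} \<or> real (card G) < M"
    | k where "k \<in> T" "M \<le> real (card G)" "real (card G) < 16 * M"
    | "T \<noteq> {}" "G \<noteq> {}" "16 * M \<le> real (card G)"
    by force
  then show ?thesis
  proof cases
    case 1
    then have "Rfun M (card G) (card T) = 0"
      by (auto simp: Rfun_eq_0)
    then show ?thesis
      using expected_rate_nonneg[OF D] slack_nonneg by simp
  next
    case 2
    then show ?thesis
      using T unif by (intro Rfun_le_expected_rate_large_cache[OF D G]) auto
  next
    case 3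
    then show ?thesis
      using unif by (intro Rfun_le_expected_rate_small_cache[OF D G _ T]) auto
  qed
qed

end

section \<open>Conditioning on the users requesting from a group\<close>

lemma bind_map_cond_pmf: "bind_pmf (map_pmf f p) (\<lambda>y. cond_pmf p {x. f x = y}) = p"
  by (rule bind_cond_pmf_cancel) (auto simp: vimage_def)

lemma pmf_cond_ge:
  assumes A: "set_pmf p \<inter> A \<noteq> {}" "x \<in> A" and c: "0 < c" "measure_pmf.prob p A \<le> c * pmf p x"
  shows "1 / c \<le> pmf (cond_pmf p A) x"
proof -
  have "measure_pmf.prob p A > 0"
    using A(1) by (auto simp: measure_pmf_posI)
  then show ?thesis
    using A c by (simp add: pmf_cond field_simps)
qed

lemma map_pmf_mem_eq_bernoulli_pmf: "map_pmf (\<lambda>x. x \<in> A) p = bernoulli_pmf (measure_pmf.prob p A)"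
proof (rule pmf_eqI)
  fix b
  show "pmf (map_pmf (\<lambda>x. x \<in> A) p) b = pmf (bernoulli_pmf (measure_pmf.prob p A)) b"
    using measure_pmf.prob_compl[of A p]
    by (cases b) (auto simp: pmf_map vimage_def Compl_eq_Diff_UNIV[symmetric] Compl_eq)
qed

lemma demand_pmf_conditioned:
  "demand_pmf K (\<lambda>_. q) = bind_pmf (Pi_pmf {..<K} False (\<lambda>_. bernoulli_pmf (measure_pmf.prob q G)))
     (\<lambda>t. demand_pmf K (\<lambda>k. cond_pmf q {n. (n \<in> G) = t k}))"
proof -
  have "demand_pmf K (\<lambda>_. q)
      = Pi_pmf {..<K} undefined (\<lambda>_.
          bind_pmf (map_pmf (\<lambda>n. n \<in> G) q) (\<lambda>y. cond_pmf q {n. (n \<in> G) = y}))"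
    by (simp only: demand_pmf_def bind_map_cond_pmf)
  then show ?thesis
    unfolding map_pmf_mem_eq_bernoulli_pmf demand_pmf_def
    by (simp only: Pi_pmf_bind[where d' = False] finite_lessThan)
qed

lemma set_pmf_Int_nonempty_if_Pi_bernoulli:
  assumes "finite A" "t \<in> set_pmf (Pi_pmf A dflt (\<lambda>_. bernoulli_pmf (measure_pmf.prob q G)))" "k \<in> A"
  shows "set_pmf q \<inter> {n. (n \<in> G) = t k} \<noteq> {}"
proof -
  have "t k \<in> set_pmf (map_pmf (\<lambda>n. n \<in> G) q)"
    using assms unfolding map_pmf_mem_eq_bernoulli_pmf by (simp add: set_Pi_pmf PiE_dflt_def)
  then show ?thesis by auto
qed

lemma (in cut_set_rates) expected_Rfun_le_expected_rate:
  assumes q: "set_pmf q \<subseteq> {1..N}" and G: "G \<subseteq> {1..N}"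
    and unif: "\<And>i. i \<in> G \<Longrightarrow> measure_pmf.prob q G \<le> 2 * real (card G) * pmf q i"
  shows "measure_pmf.expectation (binomial_pmf K (measure_pmf.prob q G)) (Rfun M (card G)) / 160
    \<le> measure_pmf.expectation (demand_pmf K (\<lambda>_. q)) r + \<delta>"
proof -
  define \<tau> where "\<tau> = Pi_pmf {..<K} False (\<lambda>_. bernoulli_pmf (measure_pmf.prob q G))"
  define T where "T t = {k \<in> {..<K}. t k}" for t
  define D where "D t k = cond_pmf q {n. (n \<in> G) = t k}" for t and k :: nat
  have fin: "finite (set_pmf \<tau>)"
    unfolding \<tau>_def by (subst set_Pi_pmf) (auto intro!: finite_PiE_dflt)
  have possible: "set_pmf q \<inter> {n. (n \<in> G) = t k} \<noteq> {}" if "t \<in> set_pmf \<tau>" "k < K" for t k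
    using that by (intro set_pmf_Int_nonempty_if_Pi_bernoulli[of "{..<K}"]) (simp_all add: \<tau>_def)
  have set_D: "\<forall>k<K. set_pmf (D t k) \<subseteq> {1..N}" if "t \<in> set_pmf \<tau>" for t
    unfolding D_def using possible[OF that] q by auto
  have "measure_pmf.expectation \<tau> (\<lambda>t. Rfun M (card G) (card (T t)) / 160 - \<delta>)
      \<le> measure_pmf.expectation (bind_pmf \<tau> (\<lambda>t. demand_pmf K (D t))) r"
  proof (rule expectation_bind_pmf_ge[OF fin finite_set_demand_pmf[OF set_D]])
    fix t assume t: "t \<in> set_pmf \<tau>"
    have "1 / (2 * real (card G)) \<le> pmf (D t k) i" if k: "k \<in> T t" and i: "i \<in> G" for k i
    proof -
      have "set_pmf q \<inter> G \<noteq> {}"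
        using possible[OF t, of k] k by (auto simp: T_def)
      moreover have "0 < card G"
        using i finite_subset[OF G] by (auto simp: card_gt_0_iff)
      ultimately show ?thesis
        using pmf_cond_ge[of q G i "2 * real (card G)"] k i unif by (simp add: D_def T_def)
    qed
    then show "Rfun M (card G) (card (T t)) / 160 - \<delta>
        \<le> measure_pmf.expectation (demand_pmf K (D t)) r"
      using set_D[OF t] G by (intro Rfun_le_expected_rate) (auto simp: T_def)
  qed
  then have "measure_pmf.expectation \<tau> (\<lambda>t. Rfun M (card G) (card (T t)) / 160)
      \<le> measure_pmf.expectation (demand_pmf K (\<lambda>_. q)) r + \<delta>"
    using integrable_measure_pmf_finite[OF fin, of "\<lambda>t. Rfun M (card G) (card (T t))"]
    unfolding demand_pmf_conditioned[of K q G] \<tau>_def D_def by simp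
  moreover have "binomial_pmf K (measure_pmf.prob q G) = map_pmf (\<lambda>t. card (T t)) \<tau>"
    unfolding \<tau>_def T_def by (rule binomial_pmf_altdef') auto
  ultimately show ?thesis
    by simp
qed

section \<open>The lower bound\<close>

lemma achievable_imp_cut_set_rates:
  assumes ach: "achievable M N K p R" and M: "0 \<le> M" and e: "e > 0"
  obtains \<delta> r where "cut_set_rates M N K \<delta> r" "expected_rate p N K r + \<delta> \<le> R + e"
proof -
  define eps where "eps = min (e / 2) (1 / (2 * (real N + 1)))"
  have eps: "eps > 0" "eps \<le> e / 2" unfolding eps_def using e by auto
  have "real N * eps \<le> real N * (1 / (2 * (real N + 1)))"
    unfolding eps_def by (intro mult_left_mono) auto
  also have "\<dots> \<le> 1 / 2" by (simp add: field_simps)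
  finally have N_eps: "real N * eps \<le> 1 / 2" .
  obtain F0 where F0: "\<And>F. F \<ge> F0 \<Longrightarrow> good_scheme M N K p F eps (R + eps)"
    using ach eps unfolding achievable_def by blast
  define F where "F = max (Suc F0) (nat \<lceil>2 * (real K + 1) / e\<rceil>)"
  have F: "F \<ge> F0" "F > 0" unfolding F_def by auto
  have "2 * (real K + 1) / e \<le> real F" unfolding F_def by linarith
  then have "(real K + 1) / real F \<le> e / 2" using e F by (simp add: field_simps)
  moreover obtain r where r: "cut_set_rates M N K ((real K + 1) / real F) r"
    "expected_rate p N K r \<le> R + eps"
    using good_scheme_imp_cut_set_rates[OF F0[OF F(1)] F(2) M eps(1) N_eps] by blast
  ultimately have "expected_rate p N K r + (real K + 1) / real F \<le> R + e"
    using eps(2) by linarith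
  with r(1) show thesis by (rule that)
qed

lemma sum_demand_prob:
  assumes "(\<Sum>n\<in>{1..N}. p n) = 1"
  shows "(\<Sum>d\<in>demands N K. demand_prob p K d) = 1"
  unfolding demands_def demand_prob_def
  using assms by (subst prod_sum_PiE[symmetric]) auto

text \<open>Without this \<open>Rstar\<close> could be the unspecified infimum of the empty set.\<close>

lemma achievable_send_all:
  assumes M: "0 \<le> M" and p: "(\<Sum>n\<in>{1..N}. p n) = 1"
  shows "achievable M N K p (real N)"
  unfolding achievable_def
proof (intro allI impI exI[of _ 1])
  fix eps :: real and F :: nat assume eps: "eps > 0" and F: "1 \<le> F"
  obtain enc where enc: "bij_betw enc (libraries N F) {xs :: bool list. length xs = F * N}"
    using finite_same_card_bij[OF finite_libraries finite_bool_lists_length]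
    by (metis card_libraries card_bool_lists_length)
  define dec :: "nat \<Rightarrow> (nat \<Rightarrow> nat) \<Rightarrow> bool list \<Rightarrow> bool list \<Rightarrow> bool list"
    where "dec k d x c = inv_into (libraries N F) enc x (d k)" for k d x c
  have "dec k d (enc W) c = W (d k)" if "W \<in> libraries N F" for k d c W
    using bij_betw_inv_into_left[OF enc that] by (simp add: dec_def)
  then have "error_prob N K F (\<lambda>_ _. []) (\<lambda>_. enc) dec d = 0" for d
    by (auto simp: error_prob_def)
  moreover have "length (enc W) = F * N" if "W \<in> libraries N F" for W
    using bij_betwE[OF enc] that by blast
  moreover have "(\<Sum>d\<in>demands N K. demand_prob p K d * (real (F * N) / real F)) = real N"
    unfolding sum_distrib_right[symmetric] sum_demand_prob[OF p] using F by simp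
  ultimately show "good_scheme M N K p F eps (real N + eps)"
    unfolding good_scheme_def using M eps
    by (intro exI[of _ "\<lambda>_ _. []"] exI[of _ "\<lambda>_. enc"] exI[of _ dec] exI[of _ "\<lambda>_. F * N"]) auto
qed

lemma Rstar_geI:
  assumes M: "0 \<le> M" and p: "(\<Sum>n\<in>{1..N}. p n) = 1"
    and bound: "\<And>\<delta> r. cut_set_rates M N K \<delta> r \<Longrightarrow> B \<le> expected_rate p N K r + \<delta>"
  shows "B \<le> Rstar M N K p"
  unfolding Rstar_def
proof (rule cInf_greatest)
  show "{R. achievable M N K p R} \<noteq> {}"
    using achievable_send_all[OF M p] by blast
  show "B \<le> R" if R: "R \<in> {R. achievable M N K p R}" for R
  proof (rule field_le_epsilon)
    fix e :: real assume "e > 0"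
    with R M obtain \<delta> r where "cut_set_rates M N K \<delta> r" "expected_rate p N K r + \<delta> \<le> R + e"
      using achievable_imp_cut_set_rates by blast
    then show "B \<le> R + e"
      using bound by fastforce
  qed
qed

lemma obtain_pmf_of_weights:
  assumes "finite A" and "\<And>x. x \<in> A \<Longrightarrow> 0 \<le> w x" and "(\<Sum>x\<in>A. w x) = 1"
  obtains q where "set_pmf q \<subseteq> A" "\<And>x. x \<in> A \<Longrightarrow> pmf q x = w x"
proof -
  define w' where "w' x = (if x \<in> A then w x else 0)" for x
  have nonneg: "0 \<le> w' x" for x
    using assms(2) by (simp add: w'_def)
  have "(\<integral>\<^sup>+ x. ennreal (w' x) \<partial>count_space UNIV) = (\<Sum>x\<in>A. ennreal (w' x))"
    using assms(1) by (intro nn_integral_count_space') (auto simp: w'_def)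
  also have "\<dots> = 1"
    using assms nonneg by (subst sum_ennreal) (auto simp: w'_def)
  finally have total: "(\<integral>\<^sup>+ x. ennreal (w' x) \<partial>count_space UNIV) = 1" .
  show thesis
    by (rule that[of "embed_pmf w'"])
      (auto simp: pmf_embed_pmf[OF nonneg total] set_embed_pmf[OF nonneg total] w'_def
        split: if_splits)
qed

lemma expectation_demand_pmf:
  assumes q: "set_pmf q \<subseteq> {1..N}" "\<And>n. n \<in> {1..N} \<Longrightarrow> pmf q n = p n"
  shows "measure_pmf.expectation (demand_pmf K (\<lambda>_. q)) r = expected_rate p N K r"
proof -
  have "pmf (demand_pmf K (\<lambda>_. q)) d = demand_prob p K d" if d: "d \<in> demands N K" for d
  proof -
    have "d k = undefined" if "k \<notin> {..<K}" for k
      using d that unfolding demands_def by (rule PiE_arb)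
    then show ?thesis
      using demands_mem[OF d] q(2) by (auto simp: demand_pmf_def demand_prob_def pmf_Pi)
  qed
  then have "expected_rate p N K r = (\<Sum>d\<in>demands N K. pmf (demand_pmf K (\<lambda>_. q)) d *\<^sub>R r d)"
    by (simp add: expected_rate_def)
  also have "\<dots> = measure_pmf.expectation (demand_pmf K (\<lambda>_. q)) r"
    using set_demand_pmf_subset[of K "\<lambda>_. q"] q(1) by (intro integral_measure_pmf[symmetric]) auto
  finally show ?thesis ..
qed

theorem Rstar_ge_single_group:
  assumes M: "0 \<le> M" and p: "\<And>n. n \<in> {1..N} \<Longrightarrow> 0 \<le> p n" "(\<Sum>n\<in>{1..N}. p n) = 1"
    and G: "G \<subseteq> {1..N}" "\<And>i. i \<in> G \<Longrightarrow> (\<Sum>n\<in>G. p n) \<le> 2 * real (card G) * p i"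
  shows "measure_pmf.expectation (binomial_pmf K (\<Sum>n\<in>G. p n)) (Rfun M (card G)) / 160
    \<le> Rstar M N K p"
proof -
  obtain q where q: "set_pmf q \<subseteq> {1..N}" "\<And>n. n \<in> {1..N} \<Longrightarrow> pmf q n = p n"
    using obtain_pmf_of_weights[of "{1..N}" p] p by blast
  have prob: "measure_pmf.prob q G = (\<Sum>n\<in>G. p n)"
    using finite_subset[OF G(1)] G(1) q(2)
    by (subst measure_measure_pmf_finite) (auto intro!: sum.cong)
  show ?thesis
  proof (rule Rstar_geI[OF M p(2)])
    fix \<delta> r assume "cut_set_rates M N K \<delta> r"
    then interpret cut_set_rates M N K \<delta> r .
    have "measure_pmf.prob q G \<le> 2 * real (card G) * pmf q i" if "i \<in> G" for i
      using G(2)[OF that] q(2)[of i] G(1) that by (auto simp: prob)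
    then show "measure_pmf.expectation (binomial_pmf K (\<Sum>n\<in>G. p n)) (Rfun M (card G)) / 160
        \<le> expected_rate p N K r + \<delta>"
      using expected_Rfun_le_expected_rate[OF q(1) G(1)] expectation_demand_pmf[OF q, of K r]
      by (simp add: prob)
  qed
qed

lemma
  assumes pos: "\<forall>n\<in>{1..N}. p n > 0"
    and mono: "\<forall>n\<in>{1..N}. \<forall>m\<in>{1..N}. n \<le> m \<longrightarrow> p m \<le> p n"
    and l: "l < num_groups p N"
  shows group_subset: "group p N l \<subseteq> {1..N}"
    and sum_group_le: "i \<in> group p N l \<Longrightarrow>
      (\<Sum>n\<in>group p N l. p n) \<le> 2 * real (card (group p N l)) * p i"
proof -
  define start where "start = grp_start p N l"
  define stop where "stop = grp_end p N start"
  have group_eq: "group p N l = {start..stop}"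
    by (simp add: group_def start_def stop_def)
  have start: "1 \<le> start"
    unfolding start_def by (cases l) auto
  have "start \<le> N"
    using not_less_Least[OF l[unfolded num_groups_def]] by (simp add: start_def)
  then have "start \<in> {m \<in> {start..N}. p m \<ge> p start / 2}"
    using pos start by (simp add: less_imp_le)
  then have "stop \<in> {m \<in> {start..N}. p m \<ge> p start / 2}"
    unfolding stop_def grp_end_def by (intro Max_in) auto
  then have stop: "stop \<le> N" "p start \<le> 2 * p stop"
    by auto
  show subset: "group p N l \<subseteq> {1..N}"
    using group_eq start stop by auto
  assume i: "i \<in> group p N l"
  have "p n \<le> 2 * p i" if n: "n \<in> group p N l" for n
  proof -
    have "p n \<le> p start"
      using n group_eq start subset by (intro mono[rule_format]) auto
    moreover have "p stop \<le> p i"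
      using i group_eq stop subset by (intro mono[rule_format]) auto
    ultimately show ?thesis
      using stop by linarith
  qed
  then show "(\<Sum>n\<in>group p N l. p n) \<le> 2 * real (card (group p N l)) * p i"
    using sum_bounded_above[of "group p N l" p "2 * p i"] by simp
qed

theorem theorem2:
  "\<exists>c::real. c > 0 \<and>
    (\<forall>(N::nat) (K::nat) (M::real) (p::nat \<Rightarrow> real).
       N \<ge> 1 \<longrightarrow> M \<ge> 0 \<longrightarrow>
       (\<forall>n\<in>{1..N}. p n > 0) \<longrightarrow>
       (\<forall>n\<in>{1..N}. \<forall>m\<in>{1..N}. n \<le> m \<longrightarrow> p m \<le> p n) \<longrightarrow>
       (\<Sum>n\<in>{1..N}. p n) = 1 \<longrightarrow>
       Rstar M N K p \<ge>
         1 / (c * real (num_groups p N)) *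
         (\<Sum>l<num_groups p N.
            measure_pmf.expectation
              (binomial_pmf K (\<Sum>n\<in>group p N l. p n))
              (\<lambda>k. Rfun M (card (group p N l)) k)))"
proof (intro exI[of _ "160 :: real"] conjI allI impI)
  fix N K :: nat and M :: real and p :: "nat \<Rightarrow> real"
  assume M: "M \<ge> 0" and pos: "\<forall>n\<in>{1..N}. p n > 0"
    and mono: "\<forall>n\<in>{1..N}. \<forall>m\<in>{1..N}. n \<le> m \<longrightarrow> p m \<le> p n"
    and total: "(\<Sum>n\<in>{1..N}. p n) = 1"
  let ?L = "num_groups p N"
  let ?E = "\<lambda>l. measure_pmf.expectation (binomial_pmf K (\<Sum>n\<in>group p N l. p n))
    (\<lambda>k. Rfun M (card (group p N l)) k)"
  have nonneg: "0 \<le> p n" if "n \<in> {1..N}" for n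
    using pos that by (simp add: less_imp_le)
  have "?E l / 160 \<le> Rstar M N K p" if "l < ?L" for l
    by (rule Rstar_ge_single_group[OF M nonneg total group_subset[OF pos mono that]
          sum_group_le[OF pos mono that]])
  then have "(\<Sum>l<?L. ?E l) \<le> real ?L * (160 * Rstar M N K p)"
    using sum_bounded_above[of "{..<?L}" ?E "160 * Rstar M N K p"] by fastforce
  moreover have "0 \<le> Rstar M N K p"
    using Rstar_ge_single_group[OF M nonneg total, of "{}"] by simp
  ultimately show "Rstar M N K p \<ge> 1 / (160 * real ?L) * (\<Sum>l<?L. ?E l)"
    by (cases "?L = 0") (simp_all add: divide_le_eq mult_ac)
qed simp

end
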